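(* Let $L=\langle R_i:i\in I\rangle$ be a relational language, $X$ a non-empty set and $\mathcal T$ a set of $L_{\infty\omega}$-sentences. Then: (a) the set $\operatorname{Int}^{\mathcal T}_L(X)$ is isomorphism-invariant; (b) $(\operatorname{Int}^{\mathcal T}_L(X))^c=\operatorname{Int}^{\mathcal T^c}_L(X)$, and this set is isomorphism-invariant; (c) maximal and minimal elements of $\langle\operatorname{Int}^{\mathcal T}_L(X),\subseteq\rangle$ are reversible interpretations; (d) for $\tau\in\operatorname{Int}_L(X)$: $\tau\in\operatorname{Max}\operatorname{Int}^{\mathcal T}_L(X)$ iff $\tau^c\in\operatorname{Min}\operatorname{Int}^{\mathcal T^c}_L(X)$.
   Context: $\operatorname{ar}(R_i)=n_i\in\mathbb N$. $\operatorname{Int}_L(X)=\prod_{i\in I}P(X^{n_i})$, ordered componentwise by inclusion $\subseteq$; $\rho^c=\langle X^{n_i}\setminus\rho_i:i\in I\rangle$, and for $\mathcal C\subseteq\operatorname{Int}_L(X)$, $\mathcal C^c=\{\rho^c:\rho\in\mathcal C\}$. $\operatorname{Int}^{\mathcal T}_L(X)=\{\rho\in\operatorname{Int}_L(X):\langle X,\rho\rangle\models\mathcal T\}$. $\mathcal C$ is isomorphism-invariant iff whenever $\rho\in\mathcal C$ and $\langle X,\sigma\rangle\cong\langle X,\rho\rangle$ then $\sigma\in\mathcal C$. $\rho$ is reversible iff every bijective homomorphism $\langle X,\rho\rangle\to\langle X,\rho\rangle$ is an automorphism. $L_{\infty\omega}$-formulas (with variables $v_\alpha$, $\alpha<\kappa$,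 $\kappa$ an infinite cardinal) are built from atomic formulas $v_\alpha=v_\beta$ and $R_i(v_{\alpha_1},\dots,v_{\alpha_{n_i}})$ by $\neg$, $\forall v_\alpha$, $\exists v_\alpha$, and conjunctions $\bigwedge\Phi$ and disjunctions $\bigvee\Phi$ of arbitrary sets $\Phi$ of formulas. For a formula $\varphi$ the formula $\varphi^c$ is defined recursively: $(v_\alpha=v_\beta)^c=v_\alpha=v_\beta$; $(R_i(\bar v))^c=\neg R_i(\bar v)$; $(\neg\varphi)^c=\neg\varphi^c$; $(\forall v_\alpha\varphi)^c=\forall v_\alpha\varphi^c$; $(\exists v_\alpha\varphi)^c=\exists v_\alpha\varphi^c$; $(\bigwedge\Phi)^c=\bigwedge\{\varphi^c:\varphi\in\Phi\}$; $(\bigvee\Phi)^c=\bigvee\{\varphi^c:\varphi\in\Phi\}$. $\mathcal T^c=\{\varphi^c:\varphi\in\mathcal T\}$. *)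

theory Defs
  imports Main "HOL-Library.FuncSet" "HOL-Library.NList"
begin

text \<open>
  A relational language is given by an index set \<open>I\<close> (possibly empty) and an arity function
  \<open>ar\<close>. Variables are the elements of a type \<open>'v\<close>, which plays the role of the infinite
  cardinal \<open>\<kappa>\<close>.

  A datatype cannot recurse through arbitrary sets, so the conjunction of a set \<open>\<Phi>\<close> of formulas
  is written \<open>Conj J F\<close>, where \<open>F\<close> enumerates \<open>\<Phi> = F ` J\<close> along a set \<open>J\<close> of indices;
  likewise for disjunctions. The index type \<open>'j\<close> is a parameter: the formulas occurring in any
  set of \<open>L\<^bsub>\<infinity>\<omega>\<^esub>\<close>-formulas are all available once \<open>'j\<close> is large enough.
\<close>

datatype ('i, 'v, 'j) formula =
    Eq 'v 'v
  | Rel 'i "'v list"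
  | Neg "('i, 'v, 'j) formula"
  | Forall 'v "('i, 'v, 'j) formula"
  | Exists 'v "('i, 'v, 'j) formula"
  | Conj "'j set" "'j \<Rightarrow> ('i, 'v, 'j) formula"
  | Disj "'j set" "'j \<Rightarrow> ('i, 'v, 'j) formula"

primrec formula_of :: "'i set \<Rightarrow> ('i \<Rightarrow> nat) \<Rightarrow> ('i, 'v, 'j) formula \<Rightarrow> bool" where
  "formula_of I ar (Eq u v) \<longleftrightarrow> True"
| "formula_of I ar (Rel i vs) \<longleftrightarrow> i \<in> I \<and> length vs = ar i"
| "formula_of I ar (Neg \<phi>) \<longleftrightarrow> formula_of I ar \<phi>"
| "formula_of I ar (Forall v \<phi>) \<longleftrightarrow> formula_of I ar \<phi>"
| "formula_of I ar (Exists v \<phi>) \<longleftrightarrow> formula_of I ar \<phi>"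
| "formula_of I ar (Conj J F) \<longleftrightarrow> (\<forall>j\<in>J. formula_of I ar (F j))"
| "formula_of I ar (Disj J F) \<longleftrightarrow> (\<forall>j\<in>J. formula_of I ar (F j))"

primrec free_vars :: "('i, 'v, 'j) formula \<Rightarrow> 'v set" where
  "free_vars (Eq u v) = {u, v}"
| "free_vars (Rel i vs) = set vs"
| "free_vars (Neg \<phi>) = free_vars \<phi>"
| "free_vars (Forall v \<phi>) = free_vars \<phi> - {v}"
| "free_vars (Exists v \<phi>) = free_vars \<phi> - {v}"
| "free_vars (Conj J F) = (\<Union>j\<in>J. free_vars (F j))"
| "free_vars (Disj J F) = (\<Union>j\<in>J. free_vars (F j))"

definition sentences :: "'i set \<Rightarrow> ('i \<Rightarrow> nat) \<Rightarrow> ('i, 'v, 'j) formula set" where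
  "sentences I ar = {\<phi>. formula_of I ar \<phi> \<and> free_vars \<phi> = {}}"

primrec compl_formula :: "('i, 'v, 'j) formula \<Rightarrow> ('i, 'v, 'j) formula" where
  "compl_formula (Eq u v) = Eq u v"
| "compl_formula (Rel i vs) = Neg (Rel i vs)"
| "compl_formula (Neg \<phi>) = Neg (compl_formula \<phi>)"
| "compl_formula (Forall v \<phi>) = Forall v (compl_formula \<phi>)"
| "compl_formula (Exists v \<phi>) = Exists v (compl_formula \<phi>)"
| "compl_formula (Conj J F) = Conj J (\<lambda>j. compl_formula (F j))"
| "compl_formula (Disj J F) = Disj J (\<lambda>j. compl_formula (F j))"

text \<open>
  \<open>nlists n X\<close> is \<open>X\<^sup>n\<close>, with tuples as lists. Interpretations lie in an extensional product
  (fixed value outside \<open>I\<close>), so that equality of interpretations is equality on \<open>I\<close>.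
\<close>

definition Int_L :: "'i set \<Rightarrow> ('i \<Rightarrow> nat) \<Rightarrow> 'a set \<Rightarrow> ('i \<Rightarrow> 'a list set) set" where
  "Int_L I ar X = (\<Pi>\<^sub>E i\<in>I. Pow (nlists (ar i) X))"

definition int_le :: "'i set \<Rightarrow> ('i \<Rightarrow> 'a list set) \<Rightarrow> ('i \<Rightarrow> 'a list set) \<Rightarrow> bool" where
  "int_le I \<rho> \<sigma> \<longleftrightarrow> (\<forall>i\<in>I. \<rho> i \<subseteq> \<sigma> i)"

definition compl_int ::
  "'i set \<Rightarrow> ('i \<Rightarrow> nat) \<Rightarrow> 'a set \<Rightarrow> ('i \<Rightarrow> 'a list set) \<Rightarrow> ('i \<Rightarrow> 'a list set)" where
  "compl_int I ar X \<rho> = (\<lambda>i\<in>I. nlists (ar i) X - \<rho> i)"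

primrec sat :: "'a set \<Rightarrow> ('i \<Rightarrow> 'a list set) \<Rightarrow> ('i, 'v, 'j) formula \<Rightarrow> ('v \<Rightarrow> 'a) \<Rightarrow> bool" where
  "sat X \<rho> (Eq u v) e \<longleftrightarrow> e u = e v"
| "sat X \<rho> (Rel i vs) e \<longleftrightarrow> map e vs \<in> \<rho> i"
| "sat X \<rho> (Neg \<phi>) e \<longleftrightarrow> \<not> sat X \<rho> \<phi> e"
| "sat X \<rho> (Forall v \<phi>) e \<longleftrightarrow> (\<forall>x\<in>X. sat X \<rho> \<phi> (e(v := x)))"
| "sat X \<rho> (Exists v \<phi>) e \<longleftrightarrow> (\<exists>x\<in>X. sat X \<rho> \<phi> (e(v := x)))"
| "sat X \<rho> (Conj J F) e \<longleftrightarrow> (\<forall>j\<in>J. sat X \<rho> (F j) e)"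
| "sat X \<rho> (Disj J F) e \<longleftrightarrow> (\<exists>j\<in>J. sat X \<rho> (F j) e)"

definition models :: "'a set \<Rightarrow> ('i \<Rightarrow> 'a list set) \<Rightarrow> ('i, 'v, 'j) formula set \<Rightarrow> bool" where
  "models X \<rho> T \<longleftrightarrow> (\<forall>\<phi>\<in>T. \<forall>e \<in> UNIV \<rightarrow> X. sat X \<rho> \<phi> e)"

definition Int_T ::
  "'i set \<Rightarrow> ('i \<Rightarrow> nat) \<Rightarrow> 'a set \<Rightarrow> ('i, 'v, 'j) formula set \<Rightarrow> ('i \<Rightarrow> 'a list set) set" where
  "Int_T I ar X T = {\<rho> \<in> Int_L I ar X. models X \<rho> T}"

definition homomorphism ::
  "'i set \<Rightarrow> 'a set \<Rightarrow> ('i \<Rightarrow> 'a list set) \<Rightarrow> 'b set \<Rightarrow> ('i \<Rightarrow> 'b list set) \<Rightarrow> ('a \<Rightarrow> 'b) \<Rightarrow> bool" where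
  "homomorphism I X \<rho> Y \<sigma> f \<longleftrightarrow> f \<in> X \<rightarrow> Y \<and> (\<forall>i\<in>I. \<forall>xs\<in>\<rho> i. map f xs \<in> \<sigma> i)"

definition isomorphism ::
  "'i set \<Rightarrow> ('i \<Rightarrow> nat) \<Rightarrow> 'a set \<Rightarrow> ('i \<Rightarrow> 'a list set) \<Rightarrow> 'b set \<Rightarrow> ('i \<Rightarrow> 'b list set) \<Rightarrow>
    ('a \<Rightarrow> 'b) \<Rightarrow> bool" where
  "isomorphism I ar X \<rho> Y \<sigma> f \<longleftrightarrow>
     bij_betw f X Y \<and> (\<forall>i\<in>I. \<forall>xs \<in> nlists (ar i) X. xs \<in> \<rho> i \<longleftrightarrow> map f xs \<in> \<sigma> i)"

definition isomorphic ::
  "'i set \<Rightarrow> ('i \<Rightarrow> nat) \<Rightarrow> 'a set \<Rightarrow> ('i \<Rightarrow> 'a list set) \<Rightarrow> 'b set \<Rightarrow> ('i \<Rightarrow> 'b list set) \<Rightarrow> bool" where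
  "isomorphic I ar X \<rho> Y \<sigma> \<longleftrightarrow> (\<exists>f. isomorphism I ar X \<rho> Y \<sigma> f)"

definition isomorphism_invariant ::
  "'i set \<Rightarrow> ('i \<Rightarrow> nat) \<Rightarrow> 'a set \<Rightarrow> ('i \<Rightarrow> 'a list set) set \<Rightarrow> bool" where
  "isomorphism_invariant I ar X C \<longleftrightarrow>
     (\<forall>\<rho>\<in>C. \<forall>\<sigma>\<in>Int_L I ar X. isomorphic I ar X \<sigma> X \<rho> \<longrightarrow> \<sigma> \<in> C)"

definition reversible ::
  "'i set \<Rightarrow> ('i \<Rightarrow> nat) \<Rightarrow> 'a set \<Rightarrow> ('i \<Rightarrow> 'a list set) \<Rightarrow> bool" where
  "reversible I ar X \<rho> \<longleftrightarrow>
     (\<forall>f. homomorphism I X \<rho> X \<rho> f \<and> bij_betw f X X \<longrightarrow> isomorphism I ar X \<rho> X \<rho> f)"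

definition Max_int :: "'i set \<Rightarrow> ('i \<Rightarrow> 'a list set) set \<Rightarrow> ('i \<Rightarrow> 'a list set) set" where
  "Max_int I C = {\<rho> \<in> C. \<forall>\<sigma>\<in>C. int_le I \<rho> \<sigma> \<longrightarrow> \<sigma> = \<rho>}"

definition Min_int :: "'i set \<Rightarrow> ('i \<Rightarrow> 'a list set) set \<Rightarrow> ('i \<Rightarrow> 'a list set) set" where
  "Min_int I C = {\<rho> \<in> C. \<forall>\<sigma>\<in>C. int_le I \<sigma> \<rho> \<longrightarrow> \<sigma> = \<rho>}"

end

theory Submission
  imports Defs
begin

text \<open>
  Isomorphisms and simultaneous complementation (of the relations and of the formula) both preserve
  satisfaction. If \<open>f\<close> is a bijective endomorphism of \<open>\<rho>\<close>, then \<open>f\<close> is an isomorphism onto \<open>\<rho>\<close>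
  from its pullback along \<open>f\<close>, which contains \<open>\<rho>\<close>, whereas the pullback of \<open>\<rho>\<close> along the inverse
  of \<open>f\<close> is isomorphic to \<open>\<rho>\<close> and contained in it. In an isomorphism-invariant set, extremality
  of \<open>\<rho>\<close> thus turns the respective inclusion into an equality, so \<open>f\<close> is an automorphism.
\<close>

lemma map_assignment_in_nlists: "e \<in> UNIV \<rightarrow> X \<Longrightarrow> map e vs \<in> nlists (length vs) X"
  by (rule nlistsI) auto

lemma map_eq_self_nlists:
  assumes "\<And>x. x \<in> X \<Longrightarrow> f (g x) = x" "xs \<in> nlists n X"
  shows "map f (map g xs) = xs"
proof -
  have "x \<in> X" if "x \<in> set xs" for x using nlistsE_set[OF assms(2)] that by blast
  then show ?thesis by (simp add: assms(1) map_idI)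
qed

lemma assignment_update: "e \<in> UNIV \<rightarrow> X \<Longrightarrow> x \<in> X \<Longrightarrow> e(v := x) \<in> UNIV \<rightarrow> X"
  by auto

text \<open>Induction on the formula with the assignment left arbitrary. Injectivity of
  \<open>f\<close> handles equality and surjectivity handles the quantifiers; an atom is covered
  because \<open>formula_of\<close> fixes the length of \<open>vs\<close>, so its value is a tuple
  on which \<open>f\<close> preserves and reflects the relation.\<close>

lemma sat_isomorphism:
  assumes f: "isomorphism I ar X \<rho> Y \<sigma> f"
  shows "formula_of I ar \<phi> \<Longrightarrow> e \<in> UNIV \<rightarrow> X \<Longrightarrow> sat X \<rho> \<phi> e \<longleftrightarrow> sat Y \<sigma> \<phi> (f \<circ> e)"
proof (induction \<phi> arbitrary: e)
  case (Eq u v)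
  have "inj_on f X" using f by (simp add: isomorphism_def bij_betw_def)
  then show ?case using Eq.prems(2) by (auto simp: inj_on_eq_iff Pi_iff)
next
  case (Rel i vs)
  then show ?case
    using f map_assignment_in_nlists[OF Rel.prems(2), of vs]
    by (simp add: isomorphism_def comp_def)
next
  case (Neg \<phi>)
  then show ?case by simp
next
  case (Forall v \<phi>)
  have Y: "Y = f ` X" using f by (simp add: isomorphism_def bij_betw_def)
  \<comment> \<open>Updating before or after composing with \<open>f\<close> gives the same
    assignment, and \<open>f x\<close> runs through all of \<open>Y\<close> as \<open>x\<close> runs
    through \<open>X\<close>.\<close>
  have "sat X \<rho> \<phi> (e(v := x)) \<longleftrightarrow> sat Y \<sigma> \<phi> ((f \<circ> e)(v := f x))" if "x \<in> X" for x
    unfolding fun_upd_comp[symmetric]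
    using Forall.prems that by (intro Forall.IH assignment_update) simp_all
  then show ?case unfolding sat.simps Y by blast
next
  case (Exists v \<phi>)
  have Y: "Y = f ` X" using f by (simp add: isomorphism_def bij_betw_def)
  have "sat X \<rho> \<phi> (e(v := x)) \<longleftrightarrow> sat Y \<sigma> \<phi> ((f \<circ> e)(v := f x))" if "x \<in> X" for x
    unfolding fun_upd_comp[symmetric]
    using Exists.prems that by (intro Exists.IH assignment_update) simp_all
  then show ?case unfolding sat.simps Y by blast
next
  case (Conj J F)
  then show ?case by auto
next
  case (Disj J F)
  then show ?case by auto
qed

text \<open>Only atoms matter: the negation added by \<open>compl_formula\<close> cancels the
  complement taken in \<open>compl_int\<close>. That complement is relative to tuples over
  \<open>X\<close> of the right arity, hence the conditions on \<open>\<phi>\<close> and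
  \<open>e\<close>.\<close>

lemma sat_compl:
  "formula_of I ar \<phi> \<Longrightarrow> e \<in> UNIV \<rightarrow> X \<Longrightarrow>
    sat X (compl_int I ar X \<rho>) (compl_formula \<phi>) e \<longleftrightarrow> sat X \<rho> \<phi> e"
proof (induction \<phi> arbitrary: e)
  case (Rel i vs)
  then show ?case
    using map_assignment_in_nlists[OF Rel.prems(2), of vs] by (auto simp: compl_int_def)
qed (simp_all add: assignment_update)

lemma compl_formula_in_sentences:
  assumes "\<phi> \<in> sentences I ar"
  shows "compl_formula \<phi> \<in> sentences I ar"
proof -
  have "formula_of I ar (compl_formula \<phi>) \<longleftrightarrow> formula_of I ar \<phi>" by (induction \<phi>) auto
  moreover have "free_vars (compl_formula \<phi>) = free_vars \<phi>" by (induction \<phi>) auto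
  ultimately show ?thesis using assms by (simp add: sentences_def)
qed

lemma isomorphism_invariant_Int_T:
  assumes "T \<subseteq> sentences I ar"
  shows "isomorphism_invariant I ar X (Int_T I ar X T)"
  unfolding isomorphism_invariant_def
proof (intro ballI impI)
  fix \<rho> \<sigma>
  assume \<rho>: "\<rho> \<in> Int_T I ar X T" and \<sigma>: "\<sigma> \<in> Int_L I ar X" and "isomorphic I ar X \<sigma> X \<rho>"
  then obtain f where f: "isomorphism I ar X \<sigma> X \<rho> f" by (auto simp: isomorphic_def)
  have "sat X \<sigma> \<phi> e" if "\<phi> \<in> T" "e \<in> UNIV \<rightarrow> X" for \<phi> e
  proof -
    have "f \<in> X \<rightarrow> X" using f by (auto simp: isomorphism_def dest: bij_betw_imp_funcset)
    with that(2) have "f \<circ> e \<in> UNIV \<rightarrow> X" by auto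
    then have "sat X \<rho> \<phi> (f \<circ> e)" using \<rho> that(1) by (simp add: Int_T_def models_def)
    then show ?thesis
      using sat_isomorphism[OF f _ that(2)] that(1) assms by (auto simp: sentences_def)
  qed
  with \<sigma> show "\<sigma> \<in> Int_T I ar X T" by (simp add: Int_T_def models_def)
qed

lemma compl_int_in_Int_L: "compl_int I ar X \<rho> \<in> Int_L I ar X"
  by (auto simp: compl_int_def Int_L_def)

text \<open>Membership in \<open>Int_L\<close> supplies both ingredients: each
  \<open>\<rho> i\<close> lies inside the set of tuples in which complements are taken, and
  \<open>\<rho>\<close> has the default value outside \<open>I\<close>.\<close>

lemma compl_int_compl_int: "\<rho> \<in> Int_L I ar X \<Longrightarrow> compl_int I ar X (compl_int I ar X \<rho>) = \<rho>"
  by (rule extensionalityI[of _ I])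
    (simp_all add: compl_int_def Int_L_def PiE_iff double_diff)

lemma int_le_compl_int:
  assumes "\<rho> \<in> Int_L I ar X" "\<sigma> \<in> Int_L I ar X"
  shows "int_le I (compl_int I ar X \<rho>) (compl_int I ar X \<sigma>) \<longleftrightarrow> int_le I \<sigma> \<rho>"
proof -
  have "nlists (ar i) X - \<rho> i \<subseteq> nlists (ar i) X - \<sigma> i \<longleftrightarrow> \<sigma> i \<subseteq> \<rho> i" if "i \<in> I" for i
  proof -
    have "\<rho> i \<subseteq> nlists (ar i) X" "\<sigma> i \<subseteq> nlists (ar i) X"
      using assms that by (simp_all add: Int_L_def PiE_iff)
    then show ?thesis by blast
  qed
  then show ?thesis by (simp add: int_le_def compl_int_def)
qed

lemma models_compl:
  assumes "T \<subseteq> sentences I ar"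
  shows "models X (compl_int I ar X \<rho>) (compl_formula ` T) \<longleftrightarrow> models X \<rho> T"
proof -
  have "sat X (compl_int I ar X \<rho>) (compl_formula \<phi>) e \<longleftrightarrow> sat X \<rho> \<phi> e"
    if "\<phi> \<in> T" "e \<in> UNIV \<rightarrow> X" for \<phi> e
    using assms that by (intro sat_compl) (auto simp: sentences_def)
  then show ?thesis by (simp add: models_def)
qed

lemma compl_int_image_Int_T:
  assumes "T \<subseteq> sentences I ar"
  shows "compl_int I ar X ` Int_T I ar X T = Int_T I ar X (compl_formula ` T)"
proof (intro subset_antisym subsetI)
  fix \<sigma> assume "\<sigma> \<in> compl_int I ar X ` Int_T I ar X T"
  then show "\<sigma> \<in> Int_T I ar X (compl_formula ` T)"
    using models_compl[OF assms] compl_int_in_Int_L by (auto simp: Int_T_def)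
next
  fix \<sigma> assume \<sigma>: "\<sigma> \<in> Int_T I ar X (compl_formula ` T)"
  \<comment> \<open>The preimage of \<open>\<sigma>\<close> is its own complement; by this equation,
    \<open>models_compl\<close> at that complement speaks about \<open>\<sigma>\<close>
    itself.\<close>
  then have eq: "compl_int I ar X (compl_int I ar X \<sigma>) = \<sigma>"
    by (simp add: Int_T_def compl_int_compl_int)
  then have "compl_int I ar X \<sigma> \<in> Int_T I ar X T"
    using models_compl[OF assms, of X "compl_int I ar X \<sigma>"] \<sigma> compl_int_in_Int_L
    by (auto simp: Int_T_def)
  with eq show "\<sigma> \<in> compl_int I ar X ` Int_T I ar X T" by (metis imageI)
qed

text \<open>Complementation is an injective, order-reversing map on \<open>Int_L\<close>, so it
  exchanges maximal and minimal elements for any set \<open>C\<close> of interpretations.\<close>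

lemma Max_int_iff_compl_Min_int:
  assumes C: "C \<subseteq> Int_L I ar X" and \<tau>: "\<tau> \<in> Int_L I ar X"
  shows "\<tau> \<in> Max_int I C \<longleftrightarrow> compl_int I ar X \<tau> \<in> Min_int I (compl_int I ar X ` C)"
proof -
  have inj: "inj_on (compl_int I ar X) (Int_L I ar X)"
    by (rule inj_on_inverseI[of _ "compl_int I ar X"]) (rule compl_int_compl_int)
  have "(int_le I (compl_int I ar X \<sigma>) (compl_int I ar X \<tau>) \<longrightarrow>
      compl_int I ar X \<sigma> = compl_int I ar X \<tau>) \<longleftrightarrow> (int_le I \<tau> \<sigma> \<longrightarrow> \<sigma> = \<tau>)" if "\<sigma> \<in> C" for \<sigma>
  proof -
    have "\<sigma> \<in> Int_L I ar X" using C that by blast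
    then show ?thesis by (simp only: inj_on_eq_iff[OF inj _ \<tau>] int_le_compl_int[OF _ \<tau>])
  qed
  then show ?thesis
    by (simp add: Max_int_def Min_int_def inj_on_image_mem_iff[OF inj \<tau> C])
qed

text \<open>For bijective \<open>f\<close> this is the only interpretation in \<open>Int_L\<close>
  that makes \<open>f\<close> an isomorphism onto \<open>\<rho>\<close>. Restricting to
  \<open>I\<close> keeps it in the extensional product.\<close>

definition pullback_int ::
  "'i set \<Rightarrow> ('i \<Rightarrow> nat) \<Rightarrow> 'a set \<Rightarrow> ('a \<Rightarrow> 'b) \<Rightarrow> ('i \<Rightarrow> 'b list set) \<Rightarrow> ('i \<Rightarrow> 'a list set)" where
  "pullback_int I ar X f \<rho> = (\<lambda>i\<in>I. {xs \<in> nlists (ar i) X. map f xs \<in> \<rho> i})"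

lemma pullback_int_in_invariant:
  assumes "isomorphism_invariant I ar X C" "\<rho> \<in> C" "bij_betw f X X"
  shows "pullback_int I ar X f \<rho> \<in> C"
proof -
  have "isomorphism I ar X (pullback_int I ar X f \<rho>) X \<rho> f"
    using assms(3) by (simp add: isomorphism_def pullback_int_def)
  moreover have "pullback_int I ar X f \<rho> \<in> Int_L I ar X"
    by (auto simp: pullback_int_def Int_L_def)
  ultimately show ?thesis
    using assms(1,2) by (auto simp: isomorphism_invariant_def isomorphic_def)
qed

lemma reversible_Max_int:
  assumes inv: "isomorphism_invariant I ar X C" and C: "C \<subseteq> Int_L I ar X"
    and \<rho>: "\<rho> \<in> Max_int I C"
  shows "reversible I ar X \<rho>"
  unfolding reversible_def
proof (intro allI impI, elim conjE)
  fix f assume hom: "homomorphism I X \<rho> X \<rho> f" and f: "bij_betw f X X"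
  let ?\<sigma> = "pullback_int I ar X f \<rho>"
  have "?\<sigma> \<in> C" using pullback_int_in_invariant[OF inv _ f] \<rho> by (simp add: Max_int_def)
  moreover have "int_le I \<rho> ?\<sigma>"
    unfolding int_le_def
  proof (intro ballI subsetI)
    fix i xs assume i: "i \<in> I" and xs: "xs \<in> \<rho> i"
    \<comment> \<open>The pullback contains only tuples over \<open>X\<close> of the right arity, so
      \<open>\<rho>\<close> can lie below it only if its own tuples are of this kind.\<close>
    have "\<rho> i \<subseteq> nlists (ar i) X" using \<rho> C i by (auto simp: Max_int_def Int_L_def PiE_iff)
    then show "xs \<in> ?\<sigma> i" using hom i xs by (auto simp: pullback_int_def homomorphism_def)
  qed
  ultimately have eq: "?\<sigma> = \<rho>" using \<rho> by (simp add: Max_int_def)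
  have "xs \<in> \<rho> i \<longleftrightarrow> map f xs \<in> \<rho> i" if "i \<in> I" "xs \<in> nlists (ar i) X" for i xs
  proof -
    have "xs \<in> ?\<sigma> i \<longleftrightarrow> map f xs \<in> \<rho> i" using that by (simp add: pullback_int_def)
    then show ?thesis by (simp only: eq)
  qed
  with f show "isomorphism I ar X \<rho> X \<rho> f" by (simp add: isomorphism_def)
qed

lemma reversible_Min_int:
  assumes inv: "isomorphism_invariant I ar X C" and \<rho>: "\<rho> \<in> Min_int I C"
  shows "reversible I ar X \<rho>"
  unfolding reversible_def
proof (intro allI impI, elim conjE)
  fix f assume hom: "homomorphism I X \<rho> X \<rho> f" and f: "bij_betw f X X"
  define g where "g = inv_into X f"
  have g: "bij_betw g X X" unfolding g_def using f by (rule bij_betw_inv_into)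
  have fg: "map f (map g xs) = xs" if "xs \<in> nlists n X" for xs n
    using bij_betw_inv_into_right[OF f] that unfolding g_def by (rule map_eq_self_nlists)
  have gf: "map g (map f xs) = xs" if "xs \<in> nlists n X" for xs n
    using bij_betw_inv_into_left[OF f] that unfolding g_def by (rule map_eq_self_nlists)
  \<comment> \<open>Pulling back along the inverse amounts to taking the image under
    \<open>f\<close> of the tuples over \<open>X\<close> in \<open>\<rho>\<close>; the homomorphism
    property keeps this image inside \<open>\<rho>\<close>.\<close>
  let ?\<sigma> = "pullback_int I ar X g \<rho>"
  have "?\<sigma> \<in> C" using pullback_int_in_invariant[OF inv _ g] \<rho> by (simp add: Min_int_def)
  moreover have "int_le I ?\<sigma> \<rho>"
    unfolding int_le_def
  proof (intro ballI subsetI)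
    fix i xs assume i: "i \<in> I" and "xs \<in> ?\<sigma> i"
    then have xs: "xs \<in> nlists (ar i) X" and "map g xs \<in> \<rho> i" by (auto simp: pullback_int_def)
    \<comment> \<open>The two maps are kept unfused so that the homomorphism property applies to the
      tuple \<open>map g xs\<close>.\<close>
    then have "map f (map g xs) \<in> \<rho> i" using hom i by (simp add: homomorphism_def del: map_map)
    then show "xs \<in> \<rho> i" by (simp only: fg[OF xs])
  qed
  ultimately have eq: "?\<sigma> = \<rho>" using \<rho> by (simp add: Min_int_def)
  have "xs \<in> \<rho> i \<longleftrightarrow> map f xs \<in> \<rho> i" if i: "i \<in> I" and xs: "xs \<in> nlists (ar i) X" for i xs
  proof
    assume "xs \<in> \<rho> i"
    then show "map f xs \<in> \<rho> i" using hom i by (simp add: homomorphism_def)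
  next
    \<comment> \<open>Reflection is where minimality enters: as \<open>\<rho>\<close> equals its
      pullback along \<open>g\<close>, the inverse \<open>g\<close> also maps tuples of
      \<open>\<rho>\<close> into \<open>\<rho>\<close>.\<close>
    assume "map f xs \<in> \<rho> i"
    then have "map f xs \<in> ?\<sigma> i" by (simp only: eq)
    then have "map g (map f xs) \<in> \<rho> i" using i by (simp add: pullback_int_def del: map_map)
    then show "xs \<in> \<rho> i" by (simp only: gf[OF xs])
  qed
  with f show "isomorphism I ar X \<rho> X \<rho> f" by (simp add: isomorphism_def)
qed

theorem theorem3p2:
  fixes I :: "'i set" and ar :: "'i \<Rightarrow> nat" and X :: "'a set"
    and T :: "('i, 'v, 'j) formula set"
  assumes "infinite (UNIV :: 'v set)"
    and "X \<noteq> {}"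
    and "T \<subseteq> sentences I ar"
  shows "isomorphism_invariant I ar X (Int_T I ar X T) \<and>
    (compl_int I ar X ` Int_T I ar X T = Int_T I ar X (compl_formula ` T) \<and>
     isomorphism_invariant I ar X (Int_T I ar X (compl_formula ` T))) \<and>
    (\<forall>\<rho> \<in> Max_int I (Int_T I ar X T) \<union> Min_int I (Int_T I ar X T). reversible I ar X \<rho>) \<and>
    (\<forall>\<tau> \<in> Int_L I ar X.
       \<tau> \<in> Max_int I (Int_T I ar X T) \<longleftrightarrow>
       compl_int I ar X \<tau> \<in> Min_int I (Int_T I ar X (compl_formula ` T)))"
proof (intro conjI)
  have T': "compl_formula ` T \<subseteq> sentences I ar"
    using assms(3) compl_formula_in_sentences by blast
  have sub: "Int_T I ar X T \<subseteq> Int_L I ar X" by (auto simp: Int_T_def)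
  show inv: "isomorphism_invariant I ar X (Int_T I ar X T)"
    using assms(3) by (rule isomorphism_invariant_Int_T)
  show im: "compl_int I ar X ` Int_T I ar X T = Int_T I ar X (compl_formula ` T)"
    using assms(3) by (rule compl_int_image_Int_T)
  show "isomorphism_invariant I ar X (Int_T I ar X (compl_formula ` T))"
    using T' by (rule isomorphism_invariant_Int_T)
  show "\<forall>\<rho> \<in> Max_int I (Int_T I ar X T) \<union> Min_int I (Int_T I ar X T). reversible I ar X \<rho>"
    using reversible_Max_int[OF inv sub] reversible_Min_int[OF inv] by blast
  show "\<forall>\<tau> \<in> Int_L I ar X.
       \<tau> \<in> Max_int I (Int_T I ar X T) \<longleftrightarrow>
       compl_int I ar X \<tau> \<in> Min_int I (Int_T I ar X (compl_formula ` T))"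
    using Max_int_iff_compl_Min_int[OF sub] by (simp add: im)
qed

end
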